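(* No infinite parity function is Borel. That is, if $f \colon 2^{\mathbb{N}} \to \{0,1\}$ satisfies $f(x) \neq f(y)$ whenever $x,y \in 2^{\mathbb{N}}$ differ in exactly one bit, then $f^{-1}(\{1\})$ is not a Borel subset of $2^{\mathbb{N}}$.
   Context: $2^{\mathbb{N}}$ is the Cantor space of infinite binary strings with its usual product topology. A function $f \colon 2^{\mathbb{N}} \to \{0,1\}$ is called a parity function if $f(x) \neq f(y)$ whenever $x$ and $y$ differ in a single bit. *)

theory Defs
  imports "HOL-Analysis.Analysis"
begin

text \<open>
  The Cantor space is the type \<^typ>\<open>nat \<Rightarrow> bool\<close>, with bit 1 read as \<^const>\<open>True\<close>
  and bit 0 as \<^const>\<open>False\<close>. The topology on \<^typ>\<open>bool\<close> is discrete and the one on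
  functions is the product topology, so \<^const>\<open>borel\<close> at this type is the Borel
  sigma-algebra of the Cantor space.
\<close>

definition parity_function :: "((nat \<Rightarrow> bool) \<Rightarrow> bool) \<Rightarrow> bool" where
  "parity_function f \<longleftrightarrow> (\<forall>x y. (\<exists>!n. x n \<noteq> y n) \<longrightarrow> f x \<noteq> f y)"

end

theory Submission
  imports Defs "HOL-Probability.Infinite_Product_Measure"
begin

text \<open>
  Toss a fair coin for every bit. Let \<open>A\<close> be the set where a parity function takes the value
  \<^const>\<open>True\<close>; were it Borel, it would be an event of this probability space. Flipping a single
  bit preserves the coin-tossing measure and exchanges \<open>A\<close> with its complement. A cylinder
  restricts only finitely many bits, so some bit can be flipped without leaving it; hence \<open>A\<close> and
  its complement have the same measure inside every cylinder
  (\<open>flip_complemented_set_halves_flip_invariant_set\<close>).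

  Finite measures that agree on cylinders agree on all events, so \<open>A\<close> and its complement
  have the same measure inside every event. Inside \<open>A\<close> itself this says that \<open>A\<close> is null, and
  inside the complement that the complement is null, although together they have measure 1
  (\<open>no_measurable_set_complemented_by_all_flips\<close>). This is the zero-one law in miniature:
  \<open>A\<close> would have to be independent of itself while having probability 1/2.
\<close>

text \<open>
  A countable base makes every open set of the Cantor space a countable union of cylinders, which is
  what puts the Borel sets inside the product sigma-algebra in \<open>sets_coin_tosses\<close>.
\<close>
instance bool :: second_countable_topology
proof
  show "\<exists>B::bool set set. countable B \<and> open = generate_topology B"
  proof (intro exI[of _ UNIV] conjI ext iffI)
    show "countable (UNIV :: bool set set)"
      by (rule countable_finite) simp
    show "generate_topology UNIV S" for S :: "bool set"
      by (rule generate_topology.Basis) simp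
  qed (rule open_discrete)
qed

text \<open>
  The preimage of a cylinder under a coordinatewise map is the cylinder over the preimages of its
  sides, so invariance passes from each factor to the values on cylinders, and these determine the
  product measure.
\<close>
lemma distr_PiM_coordinatewise:
  fixes M :: "'i \<Rightarrow> 'a measure"
  assumes prob: "\<And>i. prob_space (M i)"
    and g [measurable]: "\<And>i. g i \<in> M i \<rightarrow>\<^sub>M M i"
    and invariant: "\<And>i. distr (M i) (M i) (g i) = M i"
  shows "distr (PiM UNIV M) (PiM UNIV M) (\<lambda>x i. g i (x i)) = PiM UNIV M"
proof -
  interpret product_prob_space M UNIV
    by (rule product_prob_spaceI) (rule prob)
  let ?G = "\<lambda>x i. g i (x i)"
  have G [measurable]: "?G \<in> PiM UNIV M \<rightarrow>\<^sub>M PiM UNIV M"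
    by (rule measurable_PiM_single') (auto simp: space_PiM dest: measurable_space[OF g])
  show ?thesis
  proof (rule PiM_eq)
    fix J A assume J: "finite J" "J \<subseteq> UNIV" and A: "\<And>j. j \<in> J \<Longrightarrow> A j \<in> sets (M j)"
    let ?B = "\<lambda>j. g j -` A j \<inter> space (M j)"
    have "?G -` emb UNIV J (Pi\<^sub>E J A) \<inter> space (PiM UNIV M) = emb UNIV J (Pi\<^sub>E J ?B)"
      by (auto simp: prod_emb_iff space_PiM PiE_iff measurable_space[OF g])
    then have "emeasure (distr (PiM UNIV M) (PiM UNIV M) ?G) (emb UNIV J (Pi\<^sub>E J A))
        = emeasure (PiM UNIV M) (emb UNIV J (Pi\<^sub>E J ?B))"
      using J A by (simp add: emeasure_distr sets_PiM_I)
    also have "\<dots> = (\<Prod>j\<in>J. emeasure (M j) (?B j))"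
      using J A by (intro emeasure_PiM_emb) auto
    also have "\<dots> = (\<Prod>j\<in>J. emeasure (distr (M j) (M j) (g j)) (A j))"
      using A by (intro prod.cong refl) (simp add: emeasure_distr[OF g])
    also have "\<dots> = (\<Prod>j\<in>J. emeasure (M j) (A j))"
      by (simp only: invariant)
    finally show "emeasure (distr (PiM UNIV M) (PiM UNIV M) ?G) (emb UNIV J (Pi\<^sub>E J A))
        = (\<Prod>j\<in>J. emeasure (M j) (A j))" .
  qed simp
qed

definition fair_bit :: "bool measure" where
  "fair_bit = uniform_count_measure UNIV"

definition coin_tosses :: "(nat \<Rightarrow> bool) measure" where
  "coin_tosses = PiM UNIV (\<lambda>_. fair_bit)"

definition flip_at :: "nat \<Rightarrow> (nat \<Rightarrow> bool) \<Rightarrow> nat \<Rightarrow> bool" where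
  "flip_at n x = x(n := \<not> x n)"

lemma sets_fair_bit [simp, measurable_cong]: "sets fair_bit = UNIV"
  and space_fair_bit [simp]: "space fair_bit = UNIV"
  by (simp_all add: fair_bit_def sets_uniform_count_measure space_uniform_count_measure)

lemma measurable_fair_bit: "g \<in> fair_bit \<rightarrow>\<^sub>M fair_bit"
  by (simp add: measurable_def)

lemma prob_space_fair_bit: "prob_space fair_bit"
  unfolding fair_bit_def by (rule prob_space_uniform_count_measure) auto

lemma distr_Not_fair_bit: "distr fair_bit fair_bit Not = fair_bit"
proof (rule measure_eqI)
  fix A assume "A \<in> sets (distr fair_bit fair_bit Not)"
  have "bij_betw Not (Not -` A) A"
    by (rule bij_betwI[of _ _ _ Not]) auto
  then have "card (Not -` A) = card A"
    by (rule bij_betw_same_card)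
  then show "emeasure (distr fair_bit fair_bit Not) A = emeasure fair_bit A"
    by (simp add: emeasure_distr[OF measurable_fair_bit]) (simp add: fair_bit_def emeasure_uniform_count_measure)
qed simp

lemma space_coin_tosses [simp]: "space coin_tosses = UNIV"
  by (simp add: coin_tosses_def space_PiM)

lemma sets_coin_tosses: "sets coin_tosses = sets borel"
proof -
  have "sets (borel :: bool measure) = UNIV"
    by (auto intro: borel_open open_discrete)
  then have "sets (PiM UNIV (\<lambda>_::nat. fair_bit)) = sets (PiM UNIV (\<lambda>_. borel))"
    by (intro sets_PiM_cong) simp_all
  then show ?thesis
    by (simp add: coin_tosses_def sets_PiM_equal_borel)
qed

lemma prob_space_coin_tosses: "prob_space coin_tosses"
  unfolding coin_tosses_def by (rule prob_space_PiM) (rule prob_space_fair_bit)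

text \<open>
  In this form flipping a bit is a coordinatewise map, as \<open>distr_PiM_coordinatewise\<close> requires.
\<close>
lemma flip_at_eq: "flip_at n = (\<lambda>x i. (if i = n then Not else id) (x i))"
  by (auto simp: flip_at_def fun_eq_iff)

lemma distr_flip_at: "distr coin_tosses coin_tosses (flip_at n) = coin_tosses"
  unfolding coin_tosses_def flip_at_eq
proof (rule distr_PiM_coordinatewise)
  fix i :: nat
  show "prob_space fair_bit"
    by (rule prob_space_fair_bit)
  show "(if i = n then Not else id) \<in> fair_bit \<rightarrow>\<^sub>M fair_bit"
    by (rule measurable_fair_bit)
  show "distr fair_bit fair_bit (if i = n then Not else id) = fair_bit"
    by (cases "i = n") (simp_all add: distr_Not_fair_bit id_def)
qed

lemma measurable_flip_at: "flip_at n \<in> coin_tosses \<rightarrow>\<^sub>M coin_tosses"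
  unfolding coin_tosses_def flip_at_eq
proof (rule measurable_PiM_single')
  fix i :: nat
  show "(\<lambda>x. (if i = n then Not else id) (x i)) \<in> PiM UNIV (\<lambda>_. fair_bit) \<rightarrow>\<^sub>M fair_bit"
    by (rule measurable_compose[OF _ measurable_fair_bit])
      (rule measurable_component_singleton, simp)
qed (simp add: space_PiM)

text \<open>
  Flipping the bit maps the part of \<open>C\<close> inside \<open>A\<close> onto the part outside \<open>A\<close>, and it preserves
  the measure.
\<close>
lemma flip_complemented_set_halves_flip_invariant_set:
  assumes A: "A \<in> sets coin_tosses"
    and C: "C \<in> sets coin_tosses"
    and flipA: "\<And>x. flip_at n x \<in> A \<longleftrightarrow> x \<notin> A"
    and flipC: "\<And>x. flip_at n x \<in> C \<longleftrightarrow> x \<in> C"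
  shows "emeasure coin_tosses (A \<inter> C) = emeasure coin_tosses (- A \<inter> C)"
proof -
  have "emeasure coin_tosses (A \<inter> C)
      = emeasure (distr coin_tosses coin_tosses (flip_at n)) (A \<inter> C)"
    by (simp add: distr_flip_at)
  also have "\<dots> = emeasure coin_tosses (flip_at n -` (A \<inter> C))"
    using A C by (simp add: emeasure_distr measurable_flip_at)
  also have "flip_at n -` (A \<inter> C) = - A \<inter> C"
    using flipA flipC by auto
  finally show ?thesis .
qed

text \<open>
  The halving of cylinders is extended to all events by comparing two measures, the restrictions of
  the coin-tossing measure to \<open>A\<close> and to its complement; testing their equality on \<open>A\<close> and on
  its complement then gives the contradiction.
\<close>
lemma no_measurable_set_complemented_by_all_flips:
  assumes A: "A \<in> sets coin_tosses"
    and flip: "\<And>n x. flip_at n x \<in> A \<longleftrightarrow> x \<notin> A"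
  shows False
proof -
  interpret prob_space coin_tosses
    by (rule prob_space_coin_tosses)
  have cA: "- A \<in> sets coin_tosses"
    using sets.compl_sets[OF A] by (simp add: Compl_eq_Diff_UNIV)
  let ?restr = "\<lambda>B. density coin_tosses (indicator B)"
  have restr: "emeasure (?restr B) C = emeasure coin_tosses (B \<inter> C)"
    if "B \<in> sets coin_tosses" "C \<in> sets coin_tosses" for B C
    using that by (simp add: emeasure_density indicator_inter_arith[symmetric])
  have "?restr A = ?restr (- A)"
  proof (rule measure_eqI_PiM_infinite[where I = UNIV and M = "\<lambda>_. fair_bit"])
    fix X and J :: "nat set"
    assume J: "finite J" "J \<subseteq> UNIV" and X: "\<And>i. i \<in> J \<Longrightarrow> X i \<in> sets fair_bit"
    let ?C = "prod_emb UNIV (\<lambda>_. fair_bit) J (Pi\<^sub>E J X)"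
    \<comment> \<open>This is where infinitely many bits matter: the cylinder leaves some bit free.\<close>
    obtain n where n: "n \<notin> J"
      using ex_new_if_finite[OF infinite_UNIV_nat J(1)] by blast
    have C: "?C \<in> sets coin_tosses"
      unfolding coin_tosses_def using J X by (intro sets_PiM_I) auto
    have "x \<in> ?C \<longleftrightarrow> (\<forall>j\<in>J. x j \<in> X j)" for x
      by (auto simp: prod_emb_iff PiE_iff)
    then have "flip_at n x \<in> ?C \<longleftrightarrow> x \<in> ?C" for x
      using n by (auto simp: flip_at_def)
    then have "emeasure coin_tosses (A \<inter> ?C) = emeasure coin_tosses (- A \<inter> ?C)"
      by (rule flip_complemented_set_halves_flip_invariant_set[OF A C flip])
    then show "emeasure (?restr A) ?C = emeasure (?restr (- A)) ?C"
      using A cA C by (simp only: restr)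
  next
    show "finite_measure (?restr A)"
      using restr[OF A sets.top] by (intro finite_measureI) simp
  qed (simp_all add: coin_tosses_def)
  then have "emeasure (?restr A) B = emeasure (?restr (- A)) B" for B
    by simp
  from this[of A] this[of "- A"]
  have "emeasure coin_tosses A = 0" "emeasure coin_tosses (- A) = 0"
    using A cA by (simp_all add: restr)
  then have "emeasure coin_tosses (A \<union> - A) = 0"
    using A cA by (subst plus_emeasure[symmetric]) auto
  then show False
    using emeasure_space_1 by simp
qed

theorem corollary7p12:
  fixes f :: "(nat \<Rightarrow> bool) \<Rightarrow> bool"
  assumes "parity_function f"
  shows "f -` {True} \<notin> sets (borel :: (nat \<Rightarrow> bool) measure)"
proof
  assume "f -` {True} \<in> sets (borel :: (nat \<Rightarrow> bool) measure)"
  then have meas: "f -` {True} \<in> sets coin_tosses"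
    by (simp add: sets_coin_tosses)
  have "\<exists>!k. flip_at n x k \<noteq> x k" for n x
    by (rule ex1I[of _ n]) (auto simp: flip_at_def split: if_splits)
  then have "f (flip_at n x) \<noteq> f x" for n x
    using assms by (simp add: parity_function_def)
  then have "flip_at n x \<in> f -` {True} \<longleftrightarrow> x \<notin> f -` {True}" for n x
    by auto
  with meas show False
    by (rule no_measurable_set_complemented_by_all_flips)
qed

end
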